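(* For $0<\gamma<1$ and $\varepsilon>0$ small, the largest eigenvalue of the operator $L^1(\varepsilon;\gamma)$ is negative up to ${\cal O}(\varepsilon^2)$.
   Context: Let $\theta_n=0$ for $n\le0$ and $\theta_n=-\pi$ for $n\ge1$. The discrete $0$-$\pi$ sine-Gordon equation with coupling $\varepsilon$ ($=1/a^2$, $a$ the lattice spacing) and bias current $\gamma$ is $\ddot\phi_n-\varepsilon[\phi_{n-1}-2\phi_n+\phi_{n+1}]=-\sin(\phi_n+\theta_n)+\gamma$, $n\in\mathbb Z$. For $0\le\gamma<1$ and $\varepsilon$ small, the type 1 lattice $\pi$-kink (semifluxon) $\Phi^1_\pi(n;\varepsilon;\gamma)$ is the steady state continuing (in $\varepsilon$) the uncoupled state $\Phi^1_\pi(n;0;\gamma)=\arcsin\gamma$ for $n\le0$, $=\pi+\arcsin\gamma$ for $n\ge1$. The linearization is the discrete operator on sequences $\nu=(v_n)_{n\in\mathbb Z}$, $$(L^1(\varepsilon;\gamma)\nu)_n=\varepsilon(v_{n-1}-2v_n+v_{n+1})-\cos\big(\Phi^1_\pi(n;\varepsilon;\gamma)+\theta_n\big)v_n ,$$ and $\Lambda$ is an eigenvalue if $L^1\nu=\Lambda\nu$ for a nonzero $\nu$ decaying as $|n|\to\infty$. (Perturbations $v_ne^{\lambda t}$ correspond to $\Lambda=\lambda^2$.) "Negative up to ${\cal O}(\varepsilon^2)$" refers to the expansion of the eigenvalue in $\varepsilon$ with an ${\cal O}(\varepsilon^2)$ remainder. *)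

theory Defs
  imports "HOL-Analysis.Analysis" "HOL-Library.Landau_Symbols"
begin

definition theta :: "int \<Rightarrow> real" where
  "theta n = (if n \<le> 0 then 0 else - pi)"

definition discrete_laplacian :: "(int \<Rightarrow> real) \<Rightarrow> int \<Rightarrow> real" where
  "discrete_laplacian v n = v (n - 1) - 2 * v n + v (n + 1)"

text \<open>Time-independent solutions of
  \<open>\<phi>\<^sub>n'' - \<epsilon> (\<phi>\<^sub>n\<^sub>-\<^sub>1 - 2 \<phi>\<^sub>n + \<phi>\<^sub>n\<^sub>+\<^sub>1) = - sin (\<phi>\<^sub>n + \<theta>\<^sub>n) + \<gamma>\<close>.\<close>

definition steady_state :: "real \<Rightarrow> real \<Rightarrow> (int \<Rightarrow> real) \<Rightarrow> bool" where
  "steady_state \<epsilon> \<gamma> \<phi> \<longleftrightarrow>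
     (\<forall>n. - \<epsilon> * discrete_laplacian \<phi> n = - sin (\<phi> n + theta n) + \<gamma>)"

definition uncoupled_kink1 :: "real \<Rightarrow> int \<Rightarrow> real" where
  "uncoupled_kink1 \<gamma> n = (if n \<le> 0 then arcsin \<gamma> else pi + arcsin \<gamma>)"

text \<open>A branch of steady states over the couplings \<open>0 \<le> e \<le> \<epsilon>\<close> that starts at the uncoupled
  state and depends continuously on \<open>e\<close> in the supremum norm over the lattice.\<close>

definition kink1_branch :: "real \<Rightarrow> real \<Rightarrow> (real \<Rightarrow> int \<Rightarrow> real) \<Rightarrow> bool" where
  "kink1_branch \<epsilon> \<gamma> G \<longleftrightarrow>
     G 0 = uncoupled_kink1 \<gamma> \<and>
     (\<forall>e\<in>{0..\<epsilon>}. steady_state e \<gamma> (G e)) \<and>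
     (\<forall>e\<in>{0..\<epsilon>}. uniform_limit UNIV G (G e) (at e within {0..\<epsilon>}))"

text \<open>The type 1 lattice \<open>\<pi>\<close>-kink. For \<open>0 \<le> \<gamma> < 1\<close> and \<open>\<epsilon> \<ge> 0\<close> small there is exactly one
  endpoint of such a branch; otherwise the value is unspecified.\<close>

definition kink1 :: "real \<Rightarrow> real \<Rightarrow> int \<Rightarrow> real" where
  "kink1 \<epsilon> \<gamma> = (THE \<phi>. \<exists>G. kink1_branch \<epsilon> \<gamma> G \<and> G \<epsilon> = \<phi>)"

definition L1 :: "real \<Rightarrow> real \<Rightarrow> (int \<Rightarrow> real) \<Rightarrow> int \<Rightarrow> real" where
  "L1 \<epsilon> \<gamma> v n = \<epsilon> * discrete_laplacian v n - cos (kink1 \<epsilon> \<gamma> n + theta n) * v n"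

text \<open>Eigenfunctions are only required to tend to \<open>0\<close> at both ends of the lattice;
  no summability is imposed.\<close>

definition eigenvalue :: "((int \<Rightarrow> real) \<Rightarrow> int \<Rightarrow> real) \<Rightarrow> real \<Rightarrow> bool" where
  "eigenvalue L \<Lambda> \<longleftrightarrow>
     (\<exists>v. (\<exists>n. v n \<noteq> 0) \<and> (v \<longlongrightarrow> 0) at_top \<and> (v \<longlongrightarrow> 0) at_bot \<and> (\<forall>n. L v n = \<Lambda> * v n))"

definition largest_eigenvalue :: "((int \<Rightarrow> real) \<Rightarrow> int \<Rightarrow> real) \<Rightarrow> real \<Rightarrow> bool" where
  "largest_eigenvalue L \<Lambda> \<longleftrightarrow> eigenvalue L \<Lambda> \<and> (\<forall>\<mu>. eigenvalue L \<mu> \<longrightarrow> \<mu> \<le> \<Lambda>)"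

end

theory Submission
  imports Defs
begin

text \<open>Write \<open>c = cos (arcsin \<gamma>) > 0\<close>. In \<open>u = \<Phi> + \<theta>\<close> the kink is a bounded perturbation of the constant
  \<open>arcsin \<gamma>\<close>, driven by \<open>\<epsilon> \<pi>\<close> at the site \<open>0\<close> and \<open>- \<epsilon> \<pi>\<close> at the site \<open>1\<close>; hence
  \<open>- cos u = - c + \<epsilon> V\<close> where \<open>V\<close> is, up to a uniform \<open>O(\<epsilon>)\<close>, the dipole of strength
  \<open>k = \<pi> \<gamma> / c\<close>. The discrete Schroedinger operator with the exact dipole has the explicit ground
  state level \<open>z + 1 / z - 2 > 0\<close> with \<open>z = 1 / sqrt (1 + k\<^sup>2)\<close>. For the perturbed
  potential the decaying solutions on the two half-lines come from continued fractions, which are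
  monotone in the potential; matching them at the core by the intermediate value theorem gives a
  positive decaying eigenfunction whose level is within \<open>O(\<epsilon>)\<close> of the explicit one, and a maximum
  principle shows that no larger eigenvalue exists, even without summability. So the largest
  eigenvalue is \<open>- c + \<epsilon> (z + 1 / z - 2) + O(\<epsilon>\<^sup>2)\<close>, whose leading term is negative.\<close>

subsection \<open>Contractions on boxes of bounded functions\<close>

text \<open>Applying \<open>step\<close> to the supremum \<open>S\<close> gives
  \<open>S \<le> \<kappa> * S + B\<close>; the crude bound \<open>M\<^sub>0\<close> makes
  \<open>S\<close> finite, so this can be solved for \<open>S\<close>.\<close>

lemma sup_contraction_bound:
  fixes x :: "'i \<Rightarrow> real"
  assumes "\<kappa> < 1" and bdd: "\<And>i. x i \<le> M\<^sub>0"
    and step: "\<And>M i. (\<And>j. x j \<le> M) \<Longrightarrow> x i \<le> \<kappa> * M + B"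
  shows "x i \<le> B / (1 - \<kappa>)"
proof -
  have bd: "bdd_above (range x)" using bdd by (intro bdd_aboveI2)
  have le: "x j \<le> (SUP i. x i)" for j by (rule cSUP_upper[OF _ bd]) simp
  have "(SUP i. x i) \<le> \<kappa> * (SUP i. x i) + B"
    by (rule cSUP_least) (auto intro: step le)
  then have "(SUP i. x i) * (1 - \<kappa>) \<le> B" by (simp add: algebra_simps)
  then have "(SUP i. x i) \<le> B / (1 - \<kappa>)" using assms(1) by (simp add: pos_le_divide_eq)
  with le[of i] show ?thesis by linarith
qed

text \<open>Quantifying over all uniform bounds \<open>M\<close> expresses the supremum metric for
  plain functions, on the lattice as well as on a half-line.\<close>

definition box_contraction :: "real \<Rightarrow> real \<Rightarrow> real \<Rightarrow> (('i \<Rightarrow> real) \<Rightarrow> 'i \<Rightarrow> real) \<Rightarrow> bool" where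
  "box_contraction a b \<kappa> T \<longleftrightarrow> a \<le> b \<and> 0 \<le> \<kappa> \<and> \<kappa> < 1 \<and>
     (\<forall>x. range x \<subseteq> {a..b} \<longrightarrow> range (T x) \<subseteq> {a..b}) \<and>
     (\<forall>x y M. range x \<subseteq> {a..b} \<longrightarrow> range y \<subseteq> {a..b} \<longrightarrow>
        (\<forall>i. \<bar>x i - y i\<bar> \<le> M) \<longrightarrow> (\<forall>i. \<bar>T x i - T y i\<bar> \<le> \<kappa> * M))"

text \<open>Picard iteration from the constant \<open>a\<close>. Geometric increments make the
  convergence uniform, which is what lets the limit pass through \<open>T\<close>.\<close>

lemma box_contraction_fixpoint:
  fixes T :: "('i \<Rightarrow> real) \<Rightarrow> 'i \<Rightarrow> real"
  assumes "box_contraction a b \<kappa> T"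
  obtains x where "range x \<subseteq> {a..b}" "T x = x"
proof -
  have ab: "a \<le> b" and k: "0 \<le> \<kappa>" "\<kappa> < 1"
    and maps: "\<And>x. range x \<subseteq> {a..b} \<Longrightarrow> range (T x) \<subseteq> {a..b}"
    and contr: "\<And>x y M i. range x \<subseteq> {a..b} \<Longrightarrow> range y \<subseteq> {a..b} \<Longrightarrow>
        (\<And>i. \<bar>x i - y i\<bar> \<le> M) \<Longrightarrow> \<bar>T x i - T y i\<bar> \<le> \<kappa> * M"
    using assms unfolding box_contraction_def by blast+
  define U where "U j = (T ^^ j) (\<lambda>_. a)" for j
  have U_Suc: "U (Suc j) = T (U j)" for j by (simp add: U_def)
  have U_in: "range (U j) \<subseteq> {a..b}" for j
  proof (induction j)
    case 0 then show ?case using ab by (auto simp: U_def)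
  next
    case (Suc j) then show ?case unfolding U_Suc by (rule maps)
  qed
  have diff: "\<bar>U (Suc j) i - U j i\<bar> \<le> \<kappa> ^ j * (b - a)" for i j
  proof (induction j arbitrary: i)
    case 0
    have "U 1 i \<in> {a..b}" "U 0 i \<in> {a..b}" using U_in by blast+
    then show ?case by auto
  next
    case (Suc j)
    have "\<bar>T (U (Suc j)) i - T (U j) i\<bar> \<le> \<kappa> * (\<kappa> ^ j * (b - a))"
      by (rule contr[OF U_in U_in Suc.IH])
    then show ?case by (simp add: U_Suc algebra_simps)
  qed
  define X where "X i = a + (\<Sum>j. U (Suc j) i - U j i)" for i
  have "uniform_limit UNIV (\<lambda>n i. \<Sum>j<n. U (Suc j) i - U j i) (\<lambda>i. \<Sum>j. U (Suc j) i - U j i) sequentially"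
    by (rule Weierstrass_m_test[where M = "\<lambda>j. \<kappa> ^ j * (b - a)"])
       (use diff k in \<open>auto intro!: summable_mult2 summable_geometric\<close>)
  then have "uniform_limit UNIV (\<lambda>n i. U n i - a) (\<lambda>i. X i - a) sequentially"
    by (subst (asm) sum_lessThan_telescope) (simp add: X_def U_def)
  then have lim: "\<forall>\<^sub>F n in sequentially. \<forall>i. \<bar>U n i - X i\<bar> < d" if "d > 0" for d
    using that by (auto simp: uniform_limit_iff dist_real_def)
  have X_in: "X i \<in> {a..b}" for i
  proof -
    have "(\<lambda>n. U n i) \<longlonglongrightarrow> X i"
      using eventually_mono[OF lim] by (auto simp: tendsto_iff dist_real_def)
    moreover have "U n i \<in> {a..b}" for n using U_in by blast
    ultimately show ?thesis using closed_sequentially[of "{a..b}" "\<lambda>n. U n i"] by auto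
  qed
  have "\<bar>T X i - X i\<bar> \<le> 0 + d" if "d > 0" for i d
  proof -
    have "\<forall>\<^sub>F n in sequentially. \<forall>i. \<bar>U (Suc n) i - X i\<bar> < d/2"
      by (rule eventually_sequentially_Suc[THEN iffD2]) (rule lim, use that in simp)
    moreover have "\<forall>\<^sub>F n in sequentially. \<forall>i. \<bar>U n i - X i\<bar> < d/2" using lim[of "d/2"] that by simp
    ultimately have "\<forall>\<^sub>F n in sequentially. (\<forall>i. \<bar>U (Suc n) i - X i\<bar> < d/2) \<and> (\<forall>i. \<bar>U n i - X i\<bar> < d/2)"
      by (rule eventually_conj)
    then obtain n where n: "\<And>i. \<bar>U (Suc n) i - X i\<bar> < d/2" "\<And>i. \<bar>U n i - X i\<bar> < d/2"
      using eventually_happens'[OF sequentially_bot] by blast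
    have "\<bar>T (U n) i - T X i\<bar> \<le> \<kappa> * (d/2)"
      by (rule contr) (use U_in X_in n(2) in \<open>auto intro: less_imp_le\<close>)
    also have "\<dots> \<le> d/2" using k that by (simp add: mult_le_cancel_right1)
    finally show ?thesis using n(1)[of i] unfolding U_Suc by linarith
  qed
  then have "\<bar>T X i - X i\<bar> \<le> 0" for i by (rule field_le_epsilon)
  then have "T X = X" by auto
  with X_in show ?thesis using that by blast
qed

text \<open>\<open>y\<close> is fixed by \<open>T\<close> up to a defect \<open>B\<close>, amplified
  by at most \<open>1 / (1 - \<kappa>)\<close>. This yields uniqueness (\<open>B = 0\<close>) and
  Lipschitz dependence on parameters.\<close>

lemma box_contraction_stability:
  fixes T T' :: "('i \<Rightarrow> real) \<Rightarrow> 'i \<Rightarrow> real"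
  assumes "box_contraction a b \<kappa> T"
    and "range x \<subseteq> {a..b}" "T x = x" "range y \<subseteq> {a..b}" "T' y = y"
    and B: "\<And>i. \<bar>T y i - T' y i\<bar> \<le> B"
  shows "\<bar>x i - y i\<bar> \<le> B / (1 - \<kappa>)"
proof (rule sup_contraction_bound[where x = "\<lambda>i. \<bar>x i - y i\<bar>" and M\<^sub>0 = "b - a"])
  show "\<kappa> < 1" using assms(1) by (simp add: box_contraction_def)
  show "\<bar>x j - y j\<bar> \<le> b - a" for j
  proof -
    have "x j \<in> {a..b}" "y j \<in> {a..b}" using assms(2,4) by blast+
    then show ?thesis by auto
  qed
next
  fix M j assume "\<And>j. \<bar>x j - y j\<bar> \<le> M"
  then have "\<bar>T x j - T y j\<bar> \<le> \<kappa> * M"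
    using assms(1,2,4) unfolding box_contraction_def by blast
  then show "\<bar>x j - y j\<bar> \<le> \<kappa> * M + B"
    using B[of j] unfolding assms(3,5) by linarith
qed

subsection \<open>The kink for small coupling\<close>

text \<open>The second difference of the unit step \<open>- theta n / pi\<close>.\<close>

definition dipole :: "int \<Rightarrow> real" where
  "dipole n = (if n = 0 then 1 else if n = 1 then - 1 else 0)"

lemma discrete_laplacian_minus_theta:
  "discrete_laplacian (\<lambda>n. u n - theta n) n = discrete_laplacian u n + pi * dipole n"
  by (auto simp: discrete_laplacian_def theta_def dipole_def)

lemma discrete_laplacian_diff:
  "discrete_laplacian (\<lambda>n. u n - v n) n = discrete_laplacian u n - discrete_laplacian v n"
  by (simp add: discrete_laplacian_def)

text \<open>Second differences annihilate constants, so the bound may be centred at any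
  \<open>a\<close>.\<close>

lemma abs_discrete_laplacian_le:
  assumes "\<And>n. \<bar>u n - a\<bar> \<le> M"
  shows "\<bar>discrete_laplacian u n\<bar> \<le> 4 * M"
  using assms[of "n - 1"] assms[of n] assms[of "n + 1"]
  by (simp add: discrete_laplacian_def abs_le_iff)

lemma steady_state_iff:
  "steady_state e \<gamma> (\<lambda>n. u n - theta n) \<longleftrightarrow>
     (\<forall>n. e * (discrete_laplacian u n + pi * dipole n) = sin (u n) - \<gamma>)"
  unfolding steady_state_def discrete_laplacian_minus_theta
  by (auto simp: algebra_simps)

lemma cos_Lipschitz: "\<bar>cos x - cos y\<bar> \<le> \<bar>x - y\<bar>" for x y :: real
  using field_differentiable_bound[of UNIV cos "\<lambda>x. - sin x" 1 x y]
  by (auto intro!: derivative_eq_intros)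

locale subcritical_bias =
  fixes \<gamma> :: real
  assumes bias: "0 \<le> \<gamma>" "\<gamma> < 1"
begin

definition c :: real where "c = cos (arcsin \<gamma>)"

lemma c_pos: "0 < c" and c_le_1: "c \<le> 1" and sin_arcsin_bias: "sin (arcsin \<gamma>) = \<gamma>"
  and c_square: "c\<^sup>2 = 1 - \<gamma>\<^sup>2"
proof -
  show "0 < c" unfolding c_def
    by (rule cos_gt_zero_pi) (use arcsin_lt_bounded[of \<gamma>] bias in auto)
  show "c \<le> 1" by (simp add: c_def)
  show "sin (arcsin \<gamma>) = \<gamma>" using bias by simp
  then show "c\<^sup>2 = 1 - \<gamma>\<^sup>2" unfolding c_def cos_squared_eq by simp
qed

text \<open>The derivative is \<open>(c - cos t) / c\<close>; as cosine is 1-Lipschitz, the radius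
  \<open>c / 2\<close> keeps it within \<open>1 / 2\<close>.\<close>

lemma newton_step_contraction:
  assumes "\<bar>x - arcsin \<gamma>\<bar> \<le> c / 2" "\<bar>y - arcsin \<gamma>\<bar> \<le> c / 2"
  shows "\<bar>(x - sin x / c) - (y - sin y / c)\<bar> \<le> \<bar>x - y\<bar> / 2"
proof -
  let ?S = "{arcsin \<gamma> - c / 2 .. arcsin \<gamma> + c / 2}"
  have "norm ((x - sin x / c) - (y - sin y / c)) \<le> 1 / 2 * norm (x - y)"
  proof (rule field_differentiable_bound[where S = ?S and f' = "\<lambda>t. 1 - cos t / c"])
    fix t assume "t \<in> ?S"
    then have "\<bar>t - arcsin \<gamma>\<bar> \<le> c / 2" unfolding atLeastAtMost_iff by linarith
    then have "\<bar>cos t - c\<bar> \<le> c / 2"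
      using cos_Lipschitz[of t "arcsin \<gamma>"] unfolding c_def by linarith
    moreover have "1 - cos t / c = (c - cos t) / c" using c_pos by (simp add: field_simps)
    ultimately show "norm (1 - cos t / c) \<le> 1 / 2" using c_pos
      by (simp add: abs_divide divide_simps abs_minus_commute)
    show "((\<lambda>t. t - sin t / c) has_field_derivative 1 - cos t / c) (at t within ?S)"
      using c_pos by (auto intro!: derivative_eq_intros)
  next
    show "x \<in> ?S" "y \<in> ?S" using assms unfolding atLeastAtMost_iff by linarith+
  qed simp
  then show ?thesis by simp
qed

text \<open>Newton iteration for the steady state equation in the variable \<open>u = \<phi> + \<theta>\<close>, with the slope
  frozen at the uncoupled state; the jump of \<open>\<theta>\<close> survives as the dipole forcing.\<close>

definition kink_map :: "real \<Rightarrow> (int \<Rightarrow> real) \<Rightarrow> int \<Rightarrow> real" where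
  "kink_map e u n = u n - (sin (u n) - \<gamma> - e * (discrete_laplacian u n + pi * dipole n)) / c"

lemma kink_map_fixpoint_iff:
  "kink_map e u = u \<longleftrightarrow> steady_state e \<gamma> (\<lambda>n. u n - theta n)"
  unfolding steady_state_iff kink_map_def using c_pos by (auto simp: fun_eq_iff)

abbreviation near :: "(int \<Rightarrow> real) \<Rightarrow> bool" where
  "near u \<equiv> range u \<subseteq> {arcsin \<gamma> - c / 2 .. arcsin \<gamma> + c / 2}"

lemma near_iff: "near u \<longleftrightarrow> (\<forall>n. \<bar>u n - arcsin \<gamma>\<bar> \<le> c / 2)"
proof -
  have "u n \<in> {arcsin \<gamma> - c / 2 .. arcsin \<gamma> + c / 2} \<longleftrightarrow> \<bar>u n - arcsin \<gamma>\<bar> \<le> c / 2" for n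
    unfolding atLeastAtMost_iff by linarith
  then show ?thesis by (simp only: image_subset_iff UNIV_I simp_thms ball_UNIV)
qed

lemma kink_map_forcing_le:
  assumes "near u" shows "\<bar>discrete_laplacian u n + pi * dipole n\<bar> \<le> 6"
proof -
  have "\<bar>discrete_laplacian u n\<bar> \<le> 4 * (c / 2)"
    by (rule abs_discrete_laplacian_le) (use assms near_iff in auto)
  moreover have "\<bar>pi * dipole n\<bar> \<le> 4"
    using pi_less_4 by (auto simp: dipole_def)
  ultimately show ?thesis using c_le_1 by linarith
qed

text \<open>Newton halves distances and the coupling adds little:
  \<open>c / 4 + c / 16 \<le> c / 2\<close> gives invariance,
  \<open>1 / 2 + 4 / 96 \<le> 3 / 4\<close> contraction.\<close>

lemma kink_map_contraction:
  assumes e: "0 \<le> e" "e \<le> c\<^sup>2 / 96"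
  shows "box_contraction (arcsin \<gamma> - c / 2) (arcsin \<gamma> + c / 2) (3 / 4) (kink_map e)"
proof -
  have ec: "e / c \<le> c / 96" using e c_pos by (simp add: field_simps power2_eq_square)
  have ec': "e / c \<le> 1 / 96" using ec c_le_1 by linarith
  have "near (kink_map e u)" if u: "near u" for u
    unfolding near_iff
  proof
    fix n
    let ?g = "discrete_laplacian u n + pi * dipole n"
    have "\<bar>(u n - sin (u n) / c) - (arcsin \<gamma> - sin (arcsin \<gamma>) / c)\<bar> \<le> \<bar>u n - arcsin \<gamma>\<bar> / 2"
      by (rule newton_step_contraction) (use u near_iff c_pos in auto)
    moreover have "\<bar>e / c * ?g\<bar> \<le> c / 96 * 6"
      unfolding abs_mult by (rule mult_mono) (use kink_map_forcing_le[OF u] ec e c_pos in auto)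
    moreover have "kink_map e u n - arcsin \<gamma> =
        ((u n - sin (u n) / c) - (arcsin \<gamma> - sin (arcsin \<gamma>) / c)) + e / c * ?g"
      unfolding kink_map_def sin_arcsin_bias by (simp add: diff_divide_distrib)
    then have "\<bar>kink_map e u n - arcsin \<gamma>\<bar> \<le>
        \<bar>(u n - sin (u n) / c) - (arcsin \<gamma> - sin (arcsin \<gamma>) / c)\<bar> + \<bar>e / c * ?g\<bar>"
      using abs_triangle_ineq by metis
    moreover have "\<bar>u n - arcsin \<gamma>\<bar> \<le> c / 2" using u near_iff by auto
    ultimately show "\<bar>kink_map e u n - arcsin \<gamma>\<bar> \<le> c / 2" using c_pos by argo
  qed
  moreover have "\<bar>kink_map e u n - kink_map e v n\<bar> \<le> 3 / 4 * M"
    if u: "near u" and v: "near v" and M: "\<forall>n. \<bar>u n - v n\<bar> \<le> M" for u v M n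
  proof -
    have "\<bar>(u n - sin (u n) / c) - (v n - sin (v n) / c)\<bar> \<le> \<bar>u n - v n\<bar> / 2"
      by (rule newton_step_contraction) (use u v near_iff in auto)
    moreover have "\<bar>e / c * discrete_laplacian (\<lambda>n. u n - v n) n\<bar> \<le> 1 / 96 * (4 * M)"
      unfolding abs_mult
      by (rule mult_mono) (use abs_discrete_laplacian_le[of "\<lambda>n. u n - v n" 0 M] M ec' e c_pos in \<open>auto simp del: times_divide_eq_right\<close>)
    moreover have "kink_map e u n - kink_map e v n = ((u n - sin (u n) / c) - (v n - sin (v n) / c))
        + e / c * discrete_laplacian (\<lambda>n. u n - v n) n"
      unfolding kink_map_def discrete_laplacian_diff using c_pos by (simp add: field_simps)
    then have "\<bar>kink_map e u n - kink_map e v n\<bar> \<le> \<bar>(u n - sin (u n) / c) - (v n - sin (v n) / c)\<bar>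
        + \<bar>e / c * discrete_laplacian (\<lambda>n. u n - v n) n\<bar>"
      using abs_triangle_ineq by metis
    moreover have "\<bar>u n - v n\<bar> \<le> M" using M by auto
    ultimately show ?thesis by argo
  qed
  ultimately show ?thesis unfolding box_contraction_def using c_pos by auto
qed

text \<open>The factor \<open>1 / (1 - 3 / 4)\<close> turns the forcing bound 6 into 24. The case
  \<open>e' = e\<close> is uniqueness, \<open>e' = 0\<close> the distance to the uncoupled
  state.\<close>

lemma kink_stability:
  assumes "0 \<le> e" "e \<le> c\<^sup>2 / 96"
    and "near u" "steady_state e \<gamma> (\<lambda>n. u n - theta n)"
    and "near v" "steady_state e' \<gamma> (\<lambda>n. v n - theta n)"
  shows "\<bar>u n - v n\<bar> \<le> 24 / c * \<bar>e - e'\<bar>"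
proof -
  have "\<bar>u n - v n\<bar> \<le> (\<bar>e - e'\<bar> / c * 6) / (1 - 3 / 4)"
  proof (rule box_contraction_stability[OF kink_map_contraction])
    fix n
    have "kink_map e v n - kink_map e' v n = (e - e') / c * (discrete_laplacian v n + pi * dipole n)"
      using c_pos by (simp add: kink_map_def field_simps)
    also have "\<bar>\<dots>\<bar> \<le> \<bar>e - e'\<bar> / c * 6"
      unfolding abs_mult by (rule mult_mono) (use kink_map_forcing_le assms(5) c_pos in \<open>auto simp: abs_divide\<close>)
    finally show "\<bar>kink_map e v n - kink_map e' v n\<bar> \<le> \<bar>e - e'\<bar> / c * 6" .
  qed (use assms kink_map_fixpoint_iff in auto)
  then show ?thesis by (simp add: field_simps)
qed

lemma uncoupled_near: "near (\<lambda>_. arcsin \<gamma>)"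
  and uncoupled_steady: "steady_state 0 \<gamma> (\<lambda>n. arcsin \<gamma> - theta n)"
  using c_pos by (auto simp: steady_state_iff sin_arcsin_bias simp del: sin_arcsin)

lemma kink_distance:
  assumes "0 \<le> e" "e \<le> c\<^sup>2 / 96"
    and "near u" "steady_state e \<gamma> (\<lambda>n. u n - theta n)"
  shows "\<bar>u n - arcsin \<gamma>\<bar> \<le> 24 / c * e"
  using kink_stability[OF assms uncoupled_near uncoupled_steady] assms(1) by simp

section \<open>Existence and uniqueness of the kink branch\<close>

lemma uncoupled_kink1_eq: "uncoupled_kink1 \<gamma> n = arcsin \<gamma> - theta n"
  by (simp add: uncoupled_kink1_def theta_def)

text \<open>The couplings whose state lies within \<open>c / 2\<close> of the uncoupled one form a clopen set, because
  the bound improves itself to \<open>c / 4\<close> on steady states.\<close>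

lemma kink1_branch_near:
  assumes e: "0 \<le> \<epsilon>" "\<epsilon> \<le> c\<^sup>2 / 96" and G: "kink1_branch \<epsilon> \<gamma> G" and "e \<in> {0..\<epsilon>}"
  shows "near (\<lambda>n. G e n + theta n)"
proof -
  define A where "A r = {e \<in> {0..\<epsilon>}. \<forall>n. \<bar>G e n + theta n - arcsin \<gamma>\<bar> \<le> r}" for r
  have cont: "uniform_limit UNIV G (G e) (at e within {0..\<epsilon>})" if "e \<in> {0..\<epsilon>}" for e
    using G that by (auto simp: kink1_branch_def)
  have steady: "steady_state e \<gamma> (\<lambda>n. (G e n + theta n) - theta n)" if "e \<in> {0..\<epsilon>}" for e
    using G that by (auto simp: kink1_branch_def)
  have self_improve: "A (c / 2) = A (c / 4)"
  proof -
    have "\<bar>G e n + theta n - arcsin \<gamma>\<bar> \<le> c / 4" if "e \<in> A (c / 2)" for e n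
    proof -
      have "e \<in> {0..\<epsilon>}" "near (\<lambda>n. G e n + theta n)" using that by (auto simp: A_def near_iff)
      then have "\<bar>G e n + theta n - arcsin \<gamma>\<bar> \<le> 24 / c * e"
        using kink_distance[OF _ _ _ steady] e by auto
      \<comment> \<open>The threshold \<open>c\<^sup>2 / 96\<close> is chosen to give exactly
        \<open>c / 4\<close> here.\<close>
      also have "\<dots> \<le> 24 / c * (c\<^sup>2 / 96)"
        using e \<open>e \<in> {0..\<epsilon>}\<close> c_pos by (intro mult_left_mono) auto
      also have "\<dots> = c / 4" by (simp add: power2_eq_square)
      finally show ?thesis .
    qed
    then have "A (c / 2) \<subseteq> A (c / 4)" by (auto simp: A_def)
    moreover have "x \<le> c / 2" if "x \<le> c / 4" for x using that c_pos by linarith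
    then have "A (c / 4) \<subseteq> A (c / 2)" unfolding A_def by blast
    ultimately show ?thesis by blast
  qed
  \<comment> \<open>Openness: the improved bound leaves a margin \<open>c / 4\<close>, which
    continuity in the supremum norm respects at all sites at once.\<close>
  have "openin (top_of_set {0..\<epsilon>}) (A (c / 2))"
    unfolding openin_euclidean_subtopology_iff
  proof (intro conjI ballI)
    show "A (c / 2) \<subseteq> {0..\<epsilon>}" by (auto simp: A_def)
    fix e assume "e \<in> A (c / 2)"
    then have e: "e \<in> {0..\<epsilon>}" and near: "\<And>n. \<bar>G e n + theta n - arcsin \<gamma>\<bar> \<le> c / 4"
      unfolding self_improve by (auto simp: A_def)
    have "\<forall>\<^sub>F t in at e within {0..\<epsilon>}. \<forall>n. \<bar>G t n - G e n\<bar> < c / 4"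
      using uniform_limitD[OF cont[OF e], of "c / 4"] c_pos by (simp add: dist_real_def)
    then obtain d where d: "d > 0" and
      D: "\<And>t. t \<in> {0..\<epsilon>} \<Longrightarrow> t \<noteq> e \<Longrightarrow> dist t e < d \<Longrightarrow> \<forall>n. \<bar>G t n - G e n\<bar> < c / 4"
      unfolding eventually_at by blast
    have "t \<in> A (c / 2)" if "t \<in> {0..\<epsilon>}" "dist t e < d" for t
    proof -
      have close: "\<bar>G t n - G e n\<bar> \<le> c / 4" for n
        using D[of t] that c_pos by (cases "t = e") (auto intro: less_imp_le)
      have "\<bar>G t n + theta n - arcsin \<gamma>\<bar> \<le> c / 2" for n
        using near[of n] close[of n] by linarith
      then show ?thesis using that by (auto simp: A_def)
    qed
    with d show "\<exists>d>0. \<forall>t\<in>{0..\<epsilon>}. dist t e < d \<longrightarrow> t \<in> A (c / 2)" by blast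
  qed
  moreover have "closedin (top_of_set {0..\<epsilon>}) (A (c / 2))"
  proof -
    have "continuous_on {0..\<epsilon>} (\<lambda>e. G e n)" for n
      unfolding continuous_on_def using tendsto_uniform_limitI[OF cont UNIV_I] by blast
    then have "closedin (top_of_set {0..\<epsilon>}) ({0..\<epsilon>} \<inter> (\<lambda>e. G e n + theta n - arcsin \<gamma>) -` {- (c / 2)..c / 2})" for n
      by (intro continuous_closedin_preimage continuous_intros) auto
    then have closed: "closedin (top_of_set {0..\<epsilon>}) (\<Inter>n. {0..\<epsilon>} \<inter> (\<lambda>e. G e n + theta n - arcsin \<gamma>) -` {- (c / 2)..c / 2})"
      by (intro closedin_INT) auto
    have interval: "y \<in> {- (c / 2)..c / 2} \<longleftrightarrow> \<bar>y\<bar> \<le> c / 2" for y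
      unfolding atLeastAtMost_iff by linarith
    note closed
    also have "(\<Inter>n. {0..\<epsilon>} \<inter> (\<lambda>e. G e n + theta n - arcsin \<gamma>) -` {- (c / 2)..c / 2}) = A (c / 2)"
      by (simp only: A_def vimage_def interval) blast
    finally show ?thesis .
  qed
  ultimately have "A (c / 2) = {} \<or> A (c / 2) = {0..\<epsilon>}"
    using connected_clopen[of "{0..\<epsilon>}"] by simp
  moreover have "0 \<in> A (c / 2)"
    using G e c_pos by (auto simp: A_def kink1_branch_def uncoupled_kink1_eq)
  ultimately have "e \<in> A (c / 2)" using \<open>e \<in> {0..\<epsilon>}\<close> by blast
  then show ?thesis unfolding near_iff A_def by blast
qed

text \<open>Fixed points chosen separately for each \<open>e\<close> form a Lipschitz family by
  \<open>kink_stability\<close>, hence a branch; at \<open>e = 0\<close> the distance bound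
  vanishes.\<close>

lemma kink1_exists:
  assumes "0 \<le> \<epsilon>" "\<epsilon> \<le> c\<^sup>2 / 96"
  shows "\<exists>G. kink1_branch \<epsilon> \<gamma> G"
proof -
  have "\<exists>u. near u \<and> steady_state e \<gamma> (\<lambda>n. u n - theta n)" if "e \<in> {0..\<epsilon>}" for e
  proof -
    have "box_contraction (arcsin \<gamma> - c / 2) (arcsin \<gamma> + c / 2) (3 / 4) (kink_map e)"
      using that assms by (intro kink_map_contraction) auto
    then show ?thesis
      using box_contraction_fixpoint kink_map_fixpoint_iff by metis
  qed
  then obtain U where U: "\<And>e. e \<in> {0..\<epsilon>} \<Longrightarrow> near (U e)"
      "\<And>e. e \<in> {0..\<epsilon>} \<Longrightarrow> steady_state e \<gamma> (\<lambda>n. U e n - theta n)"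
    by metis
  have lip: "\<bar>U t n - U e n\<bar> \<le> 24 / c * \<bar>t - e\<bar>" if "t \<in> {0..\<epsilon>}" "e \<in> {0..\<epsilon>}" for t e n
    by (rule kink_stability) (use that U assms in auto)
  have "uniform_limit UNIV (\<lambda>e n. U e n - theta n) (\<lambda>n. U e n - theta n) (at e within {0..\<epsilon>})"
    if e: "e \<in> {0..\<epsilon>}" for e
    unfolding uniform_limit_iff
  proof (intro allI impI)
    fix d :: real assume d: "d > 0"
    have "\<bar>U t n - U e n\<bar> < d" if "t \<in> {0..\<epsilon>}" "dist t e < d * c / 24" for t n
    proof -
      have "24 / c * \<bar>t - e\<bar> < 24 / c * (d * c / 24)"
        using that c_pos by (intro mult_strict_left_mono) (auto simp: dist_real_def)
      then show ?thesis using lip[of t e n] that e c_pos by simp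
    qed
    then show "\<forall>\<^sub>F t in at e within {0..\<epsilon>}. \<forall>n\<in>UNIV. dist (U t n - theta n) (U e n - theta n) < d"
      unfolding eventually_at using d c_pos
      by (intro exI[of _ "d * c / 24"]) (auto simp: dist_real_def)
  qed
  moreover have "(\<lambda>n. U 0 n - theta n) = uncoupled_kink1 \<gamma>"
    using kink_distance[of 0 "U 0"] U assms by (simp add: uncoupled_kink1_eq fun_eq_iff)
  ultimately have "kink1_branch \<epsilon> \<gamma> (\<lambda>e n. U e n - theta n)"
    using U by (auto simp: kink1_branch_def)
  then show ?thesis by blast
qed

text \<open>The definite description is legitimate: every branch ends at a steady state in the box,
  and \<open>kink_stability\<close> with equal couplings allows only one.\<close>

lemma kink1_steady:
  assumes "0 \<le> \<epsilon>" "\<epsilon> \<le> c\<^sup>2 / 96"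
  shows "near (\<lambda>n. kink1 \<epsilon> \<gamma> n + theta n)" "steady_state \<epsilon> \<gamma> (kink1 \<epsilon> \<gamma>)"
proof -
  have end_steady: "steady_state \<epsilon> \<gamma> (\<lambda>n. (G \<epsilon> n + theta n) - theta n)"
    and end_near: "near (\<lambda>n. G \<epsilon> n + theta n)" if "kink1_branch \<epsilon> \<gamma> G" for G
    using that assms kink1_branch_near[of \<epsilon> G \<epsilon>] by (auto simp: kink1_branch_def)
  obtain G where G: "kink1_branch \<epsilon> \<gamma> G" using kink1_exists[OF assms] ..
  have "kink1 \<epsilon> \<gamma> = G \<epsilon>" unfolding kink1_def
  proof (rule the_equality)
    show "\<exists>G'. kink1_branch \<epsilon> \<gamma> G' \<and> G' \<epsilon> = G \<epsilon>" using G by blast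
    fix \<phi> assume "\<exists>G'. kink1_branch \<epsilon> \<gamma> G' \<and> G' \<epsilon> = \<phi>"
    then obtain G' where G': "kink1_branch \<epsilon> \<gamma> G'" "G' \<epsilon> = \<phi>" by blast
    show "\<phi> = G \<epsilon>"
    proof
      fix n
      show "\<phi> n = G \<epsilon> n"
        using kink_stability[OF assms end_near[OF G'(1)] end_steady[OF G'(1)] end_near[OF G] end_steady[OF G], of n]
        by (simp add: G')
    qed
  qed
  then show "near (\<lambda>n. kink1 \<epsilon> \<gamma> n + theta n)" "steady_state \<epsilon> \<gamma> (kink1 \<epsilon> \<gamma>)"
    using end_near[OF G] end_steady[OF G] by auto
qed

text \<open>In the constant, \<open>96 / c\<close> comes from the Laplacian of \<open>u\<close> and
  \<open>(24 / c)\<^sup>2\<close> from the quadratic remainder, both via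
  \<open>kink_distance\<close>.\<close>

lemma potential_expansion:
  assumes e: "0 < e" "e \<le> c\<^sup>2 / 96"
  shows "\<bar>(c - cos (kink1 e \<gamma> n + theta n)) / e - pi * \<gamma> / c * dipole n\<bar> \<le> (96 / c + (24 / c)\<^sup>2) / c * e"
proof -
  define u where "u n = kink1 e \<gamma> n + theta n" for n
  have near: "near u" and steady: "steady_state e \<gamma> (\<lambda>n. u n - theta n)"
    using kink1_steady[of e] e by (auto simp: u_def)
  define h where "h = u n - arcsin \<gamma>"
  have dist: "\<bar>u n - arcsin \<gamma>\<bar> \<le> 24 / c * e" for n
    using kink_distance[OF _ _ near steady] e by auto
  have h: "\<bar>h\<bar> \<le> 24 / c * e" unfolding h_def by (rule dist)
  \<comment> \<open>\<open>c (c - cos u) - \<gamma> (sin u - \<gamma>) = 1 - cos h\<close> is quadratic in \<open>h\<close>, so the first-order term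
    of the potential can be read off the steady state equation exactly.\<close>
  have "cos h = cos (u n) * c + sin (u n) * \<gamma>"
    unfolding h_def cos_diff using sin_arcsin_bias by (simp add: c_def)
  then have "c * (c - cos (u n)) = \<gamma> * (sin (u n) - \<gamma>) + (1 - cos h)"
    using c_square by (simp add: algebra_simps power2_eq_square)
  moreover have "sin (u n) - \<gamma> = e * (discrete_laplacian u n + pi * dipole n)"
    using steady unfolding steady_state_iff by simp
  ultimately have "c * (c - cos (u n)) = \<gamma> * (e * (discrete_laplacian u n + pi * dipole n)) + (1 - cos h)"
    by simp
  then have eq: "(c - cos (u n)) / e - pi * \<gamma> / c * dipole n
      = (\<gamma> * discrete_laplacian u n + (1 - cos h) / e) / c"
    using e c_pos by (simp add: field_simps)
  have "\<bar>\<gamma> * discrete_laplacian u n\<bar> \<le> 1 * (4 * (24 / c * e))"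
    unfolding abs_mult by (rule mult_mono) (use bias abs_discrete_laplacian_le[OF dist] in auto)
  moreover have "\<bar>1 - cos h\<bar> \<le> (24 / c)\<^sup>2 * e * e"
  proof -
    have "1 - cos h = 2 * (sin (h / 2))\<^sup>2" using cos_double_sin[of "h / 2"] by simp
    also have "\<dots> \<le> 2 * (h / 2)\<^sup>2"
      using abs_sin_x_le_abs_x[of "h / 2"] unfolding abs_le_square_iff by simp
    also have "\<dots> \<le> h\<^sup>2" by (simp add: power2_eq_square)
    also have "\<dots> \<le> (24 / c * e)\<^sup>2" using power_mono[OF h, of 2] by simp
    finally show ?thesis by (simp add: power2_eq_square)
  qed
  then have "\<bar>(1 - cos h) / e\<bar> \<le> (24 / c)\<^sup>2 * e"
    using e by (simp only: abs_divide abs_of_pos pos_divide_le_eq)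
  ultimately have "\<bar>\<gamma> * discrete_laplacian u n + (1 - cos h) / e\<bar> \<le> (96 / c + (24 / c)\<^sup>2) * e"
    unfolding distrib_right using abs_triangle_ineq[of "\<gamma> * discrete_laplacian u n" "(1 - cos h) / e"] by simp
  then have "\<bar>(c - cos (u n)) / e - pi * \<gamma> / c * dipole n\<bar> \<le> (96 / c + (24 / c)\<^sup>2) * e / c"
    unfolding eq using c_pos by (simp add: abs_divide divide_right_mono)
  then show ?thesis by (simp add: u_def)
qed

end

subsection \<open>Decaying solutions and the ground state\<close>

text \<open>Fixed points \<open>x\<close> are the ratios \<open>x n = v (n + 1) / v n\<close> of a decaying solution of
  \<open>v n + v (n + 2) = q n * v (n + 1)\<close>.\<close>

definition riccati :: "(nat \<Rightarrow> real) \<Rightarrow> (nat \<Rightarrow> real) \<Rightarrow> nat \<Rightarrow> real" where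
  "riccati q x n = 1 / (q n - x (Suc n))"

text \<open>One-sided, so that it serves both the contraction estimate and the order comparison of
  Riccati ratios.\<close>

lemma inverse_diff_le:
  fixes A B :: real
  assumes "0 < \<delta>" "1 + \<delta> \<le> A" "1 + \<delta> \<le> B" "A - B \<le> M" "0 \<le> M"
  shows "1 / B - 1 / A \<le> 1 / (1 + \<delta>) * M"
proof -
  have "(1 + \<delta>) * 1 \<le> A * B" using assms by (intro mult_mono) auto
  then have AB: "1 + \<delta> \<le> A * B" by simp
  have "1 / B - 1 / A = (A - B) / (A * B)" using assms by (simp add: field_simps)
  also have "\<dots> \<le> M / (A * B)" using assms AB by (intro divide_right_mono) auto
  also have "\<dots> \<le> M / (1 + \<delta>)" using assms AB by (intro divide_left_mono) auto
  finally show ?thesis by simp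
qed

lemma riccati_denominator:
  fixes q x :: "nat \<Rightarrow> real"
  assumes "0 < \<delta>" "2 + \<delta> \<le> q n" "range x \<subseteq> {0..1 / (1 + \<delta>)}"
  shows "1 + \<delta> \<le> q n - x (Suc n)"
proof -
  have "x (Suc n) \<in> {0..1 / (1 + \<delta>)}" using assms(3) by blast
  moreover have "1 / (1 + \<delta>) \<le> 1" using assms(1) by (simp add: divide_le_eq)
  ultimately show ?thesis using assms(2) by auto
qed

text \<open>Coefficients at least \<open>2 + \<delta>\<close> and ratios at most 1 keep denominators
  above \<open>1 + \<delta>\<close>, which gives both invariance and contraction.\<close>

lemma riccati_contraction:
  assumes "0 < \<delta>" and q: "\<And>n. 2 + \<delta> \<le> q n"
  shows "box_contraction 0 (1 / (1 + \<delta>)) (1 / (1 + \<delta>)) (riccati q)"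
  unfolding box_contraction_def
proof (intro conjI allI impI)
  note den = riccati_denominator[where q = q, OF assms(1) q]
  fix x :: "nat \<Rightarrow> real" assume x: "range x \<subseteq> {0..1 / (1 + \<delta>)}"
  have "riccati q x n \<in> {0..1 / (1 + \<delta>)}" for n
    using den[OF x, of n] assms(1) by (auto simp: riccati_def intro!: divide_left_mono)
  then show "range (riccati q x) \<subseteq> {0..1 / (1 + \<delta>)}" by blast
  fix y :: "nat \<Rightarrow> real" and M n assume y: "range y \<subseteq> {0..1 / (1 + \<delta>)}" and M: "\<forall>i. \<bar>x i - y i\<bar> \<le> M"
  have M': "\<bar>x (Suc n) - y (Suc n)\<bar> \<le> M" using M by blast
  then have "riccati q x n - riccati q y n \<le> 1 / (1 + \<delta>) * M"
      "riccati q y n - riccati q x n \<le> 1 / (1 + \<delta>) * M"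
    unfolding riccati_def
    by (intro inverse_diff_le[OF assms(1) den den] x y; linarith)+
  then show "\<bar>riccati q x n - riccati q y n\<bar> \<le> 1 / (1 + \<delta>) * M" by linarith
qed (use assms(1) in auto)

text \<open>\<open>sup_contraction_bound\<close> with \<open>B = 0\<close> is applied to the
  positive part of \<open>y - x\<close>: raising \<open>q\<close> lowers the reciprocal, so an
  excess can only be inherited, shrunk, from \<open>Suc i\<close>.\<close>

lemma riccati_antimono:
  assumes "0 < \<delta>" and q: "\<And>n. 2 + \<delta> \<le> q n" and le: "\<And>n. q n \<le> q' n"
    and x: "range x \<subseteq> {0..1 / (1 + \<delta>)}" "riccati q x = x"
    and y: "range y \<subseteq> {0..1 / (1 + \<delta>)}" "riccati q' y = y"
  shows "y n \<le> x n"
proof -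
  have q': "2 + \<delta> \<le> q' n" for n using q[of n] le[of n] by linarith
  have "max 0 (y n - x n) \<le> 0 / (1 - 1 / (1 + \<delta>))"
  proof (rule sup_contraction_bound[where x = "\<lambda>n. max 0 (y n - x n)" and M\<^sub>0 = "1 / (1 + \<delta>)"])
    show "1 / (1 + \<delta>) < 1" using assms(1) by simp
    show "max 0 (y i - x i) \<le> 1 / (1 + \<delta>)" for i
    proof -
      have "x i \<in> {0..1 / (1 + \<delta>)}" "y i \<in> {0..1 / (1 + \<delta>)}" using x y by blast+
      then show ?thesis using assms(1) by auto
    qed
    fix M i assume "\<And>j. max 0 (y j - x j) \<le> M"
    from this[of "Suc i"] have M: "0 \<le> M" "y (Suc i) - x (Suc i) \<le> M" by auto
    have "riccati q' y i - riccati q x i \<le> 1 / (1 + \<delta>) * M"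
      unfolding riccati_def
      by (rule inverse_diff_le[OF assms(1) riccati_denominator[OF assms(1) q x(1)]
            riccati_denominator[OF assms(1) q' y(1)]]) (use M le[of i] in linarith)+
    moreover have "0 \<le> 1 / (1 + \<delta>) * M" using M assms(1) by simp
    ultimately show "max 0 (y i - x i) \<le> 1 / (1 + \<delta>) * M + 0"
      unfolding x(2) y(2) by simp
  qed
  then show ?thesis by simp
qed

text \<open>For the constant coefficient \<open>z + 1 / z\<close> the ratio is \<open>z\<close>.
  Shifting \<open>s\<close> by \<eta> outweighs \<open>U\<close>, so monotonicity compares the
  perturbed ratio with \<open>z\<close> at both ends of the window.\<close>

lemma riccati_tail:
  fixes U :: "nat \<Rightarrow> real" and z \<eta> :: real
  defines "s\<^sub>0 \<equiv> z + 1 / z - 2"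
  assumes z: "0 < z" "z < 1" and \<eta>: "0 \<le> \<eta>" "4 * \<eta> \<le> s\<^sub>0" and U: "\<And>j. \<bar>U j\<bar> \<le> \<eta>"
  obtains \<rho> :: "real \<Rightarrow> nat \<Rightarrow> real" where
    "\<And>s j. s \<in> {s\<^sub>0 - \<eta>..s\<^sub>0 + \<eta>} \<Longrightarrow> 0 < \<rho> s j \<and> \<rho> s j \<le> 1 / (1 + s\<^sub>0 / 2)"
    "\<And>s j. s \<in> {s\<^sub>0 - \<eta>..s\<^sub>0 + \<eta>} \<Longrightarrow> \<rho> s j * (2 + s - U j - \<rho> s (Suc j)) = 1"
    "continuous_on {s\<^sub>0 - \<eta>..s\<^sub>0 + \<eta>} (\<lambda>s. \<rho> s 0)"
    "\<rho> (s\<^sub>0 + \<eta>) 0 \<le> z" "z \<le> \<rho> (s\<^sub>0 - \<eta>) 0"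
proof -
  define \<delta> where "\<delta> = s\<^sub>0 / 2"
  define \<kappa> where "\<kappa> = 1 / (1 + \<delta>)"
  let ?I = "{s\<^sub>0 - \<eta>..s\<^sub>0 + \<eta>}"
  let ?q = "\<lambda>s j. 2 + s - U j"
  have "s\<^sub>0 = (1 - z)\<^sup>2 / z" using z by (simp add: s\<^sub>0_def power2_eq_square field_simps)
  then have \<delta>: "0 < \<delta>" using z by (simp add: \<delta>_def)
  \<comment> \<open>\<open>4 * \<eta> \<le> s\<^sub>0\<close> enters here:
    \<open>s - U j \<ge> s\<^sub>0 - 2 * \<eta> \<ge> s\<^sub>0 / 2\<close>.\<close>
  have q: "2 + \<delta> \<le> ?q s j" if "s \<in> ?I" for s j
    using that U[of j] \<eta> by (auto simp: \<delta>_def abs_le_iff)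
  have "\<exists>x. range x \<subseteq> {0..\<kappa>} \<and> riccati (?q s) x = x" if "s \<in> ?I" for s
    unfolding \<kappa>_def
    by (rule box_contraction_fixpoint[OF riccati_contraction[OF \<delta> q[OF that]]]) (intro exI conjI)
  then have "\<exists>\<rho>. \<forall>s\<in>?I. range (\<rho> s) \<subseteq> {0..\<kappa>} \<and> riccati (?q s) (\<rho> s) = \<rho> s"
    by (intro bchoice ballI)
  then obtain \<rho> where \<rho>: "\<And>s. s \<in> ?I \<Longrightarrow> range (\<rho> s) \<subseteq> {0..\<kappa>}"
      "\<And>s. s \<in> ?I \<Longrightarrow> riccati (?q s) (\<rho> s) = \<rho> s"
    by blast
  have den: "1 + \<delta> \<le> ?q s j - \<rho> s' (Suc j)" if "s \<in> ?I" "s' \<in> ?I" for s s' j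
    by (rule riccati_denominator[where q = "?q s", OF \<delta> q[OF that(1)] \<rho>(1)[OF that(2), unfolded \<kappa>_def]])
  have eq: "\<rho> s j = 1 / (?q s j - \<rho> s (Suc j))" if "s \<in> ?I" for s j
    using fun_cong[OF \<rho>(2)[OF that], of j] by (simp add: riccati_def)
  have pos: "0 < \<rho> s j" if "s \<in> ?I" for s j
    using den[OF that that, of j] \<delta> by (subst eq[OF that]) simp
  have lip: "\<bar>\<rho> s j - \<rho> s' j\<bar> \<le> (1 / (1 + \<delta>) * \<bar>s - s'\<bar>) / (1 - 1 / (1 + \<delta>))"
    if I: "s \<in> ?I" "s' \<in> ?I" for s s' j
  proof (rule box_contraction_stability[OF riccati_contraction[OF \<delta> q[OF I(1)]]])
    fix i
    have "riccati (?q s) (\<rho> s') i - riccati (?q s') (\<rho> s') i \<le> 1 / (1 + \<delta>) * \<bar>s - s'\<bar>"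
      "riccati (?q s') (\<rho> s') i - riccati (?q s) (\<rho> s') i \<le> 1 / (1 + \<delta>) * \<bar>s - s'\<bar>"
      unfolding riccati_def by (intro inverse_diff_le \<delta> den I; simp)+
    then show "\<bar>riccati (?q s) (\<rho> s') i - riccati (?q s') (\<rho> s') i\<bar> \<le> 1 / (1 + \<delta>) * \<bar>s - s'\<bar>"
      by linarith
  qed (use \<rho>[OF I(1)] \<rho>[OF I(2)] in \<open>auto simp: \<kappa>_def\<close>)
  have const: "range (\<lambda>_. z) \<subseteq> {0..1 / (1 + \<delta>)}" "riccati (\<lambda>_. z + 1 / z) (\<lambda>_. z) = (\<lambda>_. z)"
  proof -
    have "z * (1 + \<delta>) = (z * z + 1) / 2" using z by (simp add: \<delta>_def s\<^sub>0_def field_simps)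
    also have "\<dots> \<le> 1" using z mult_mono[of z 1 z 1] by simp
    finally show "range (\<lambda>_. z) \<subseteq> {0..1 / (1 + \<delta>)}" using z \<delta> by (auto simp: pos_le_divide_eq)
  qed (auto simp: riccati_def)
  have zq: "2 + \<delta> \<le> z + 1 / z" using \<delta> unfolding \<delta>_def s\<^sub>0_def by argo
  have top: "s\<^sub>0 + \<eta> \<in> ?I" and bot: "s\<^sub>0 - \<eta> \<in> ?I" using \<eta> by auto
  show ?thesis
  proof
    show "0 < \<rho> s j \<and> \<rho> s j \<le> 1 / (1 + s\<^sub>0 / 2)" if "s \<in> ?I" for s j
    proof -
      have "\<rho> s j \<in> {0..\<kappa>}" using \<rho>(1)[OF that] by blast
      then show ?thesis using pos[OF that] by (simp add: \<kappa>_def \<delta>_def)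
    qed
    show "\<rho> s j * (2 + s - U j - \<rho> s (Suc j)) = 1" if "s \<in> ?I" for s j
      using eq[OF that, of j] den[OF that that, of j] \<delta> by simp
    show "continuous_on ?I (\<lambda>s. \<rho> s 0)"
    proof (rule lipschitz_on_continuous_on, rule lipschitz_onI)
      show "dist (\<rho> x 0) (\<rho> y 0) \<le> 1 / (1 + \<delta>) / (1 - 1 / (1 + \<delta>)) * dist x y"
        if "x \<in> ?I" "y \<in> ?I" for x y
        using lip[OF that, of 0] by (simp add: dist_real_def)
      show "0 \<le> 1 / (1 + \<delta>) / (1 - 1 / (1 + \<delta>))" using \<delta> by simp
    qed
    show "\<rho> (s\<^sub>0 + \<eta>) 0 \<le> z"
      by (rule riccati_antimono[where q = "\<lambda>_. z + 1 / z" and x = "\<lambda>_. z", OF \<delta> zq _ const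
            \<rho>(1)[OF top, unfolded \<kappa>_def] \<rho>(2)[OF top]])
         (use U in \<open>auto simp: s\<^sub>0_def abs_le_iff algebra_simps\<close>)
    show "z \<le> \<rho> (s\<^sub>0 - \<eta>) 0"
    proof (rule riccati_antimono[where q' = "\<lambda>_. z + 1 / z" and y = "\<lambda>_. z", OF \<delta> q[OF bot] _
            \<rho>(1)[OF bot, unfolded \<kappa>_def] \<rho>(2)[OF bot] const])
      show "2 + (s\<^sub>0 - \<eta>) - U n \<le> z + 1 / z" for n
        using U[of n] by (auto simp: s\<^sub>0_def abs_le_iff)
    qed
  qed
qed

section \<open>Gluing decaying half-line solutions across the core\<close>

lemma prod_tendsto_zero:
  fixes \<rho> :: "nat \<Rightarrow> real"
  assumes "\<kappa> < 1" "\<And>j. 0 < \<rho> j \<and> \<rho> j \<le> \<kappa>"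
  shows "(\<lambda>m. \<Prod>j<m. \<rho> j) \<longlonglongrightarrow> 0"
proof (rule tendsto_sandwich[OF _ _ tendsto_const])
  show "\<forall>\<^sub>F m in sequentially. 0 \<le> (\<Prod>j<m. \<rho> j)"
    using assms(2) by (intro always_eventually allI prod_nonneg) (auto intro: less_imp_le)
  have "(\<Prod>j<m. \<rho> j) \<le> (\<Prod>j<m. \<kappa>)" for m
    using assms(2) by (intro prod_mono) (auto intro: less_imp_le)
  then show "\<forall>\<^sub>F m in sequentially. (\<Prod>j<m. \<rho> j) \<le> \<kappa> ^ m"
    by (simp add: always_eventually)
  have "0 < \<kappa>" using assms(2)[of 0] by linarith
  then show "(\<lambda>m. \<kappa> ^ m) \<longlonglongrightarrow> 0" using assms(1) by (intro LIMSEQ_power_zero) auto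
qed

lemma filterlim_nat_diff_at_top: "filterlim (\<lambda>n. nat (n - 1)) at_top at_top"
  unfolding filterlim_at_top
proof
  fix Z show "\<forall>\<^sub>F n in at_top. Z \<le> nat (n - 1)"
    by (rule eventually_mono[OF eventually_ge_at_top[of "int Z + 1"]]) linarith
qed

lemma filterlim_nat_minus_at_bot: "filterlim (\<lambda>n. nat (- n)) at_top at_bot"
  unfolding filterlim_at_top
proof
  fix Z show "\<forall>\<^sub>F n in at_bot. Z \<le> nat (- n)"
    by (rule eventually_mono[OF eventually_le_at_bot[of "- int Z"]]) linarith
qed

text \<open>Ratios point away from the core: \<open>\<sigma> j\<close> leads from the site
  \<open>- j\<close> to \<open>- j - 1\<close>, \<open>\<rho> j\<close> from \<open>j + 1\<close> to
  \<open>j + 2\<close>. The value is 1 at the site 0 and \<open>b\<close> at the site 1.\<close>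

definition glue :: "real \<Rightarrow> (nat \<Rightarrow> real) \<Rightarrow> (nat \<Rightarrow> real) \<Rightarrow> int \<Rightarrow> real" where
  "glue b \<sigma> \<rho> n = (if n \<le> 0 then \<Prod>j<nat (- n). \<sigma> j else b * (\<Prod>j<nat (n - 1). \<rho> j))"

lemma glue_pos:
  assumes "0 < b" "\<And>j. 0 < \<sigma> j" "\<And>j. 0 < \<rho> j"
  shows "0 < glue b \<sigma> \<rho> n"
  using assms by (auto simp: glue_def intro!: mult_pos_pos prod_pos)

lemma glue_tendsto:
  assumes "\<kappa> < 1" "\<And>j. 0 < \<sigma> j \<and> \<sigma> j \<le> \<kappa>" "\<And>j. 0 < \<rho> j \<and> \<rho> j \<le> \<kappa>"
  shows "(glue b \<sigma> \<rho> \<longlongrightarrow> 0) at_top" "(glue b \<sigma> \<rho> \<longlongrightarrow> 0) at_bot"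
proof -
  have "((\<lambda>n. b * (\<Prod>j<nat (n - 1). \<rho> j)) \<longlongrightarrow> b * 0) at_top"
    by (intro tendsto_intros filterlim_compose[OF prod_tendsto_zero[OF assms(1,3)] filterlim_nat_diff_at_top])
  moreover have "\<forall>\<^sub>F n in at_top. b * (\<Prod>j<nat (n - 1). \<rho> j) = glue b \<sigma> \<rho> n"
    using eventually_gt_at_top[of 0] by eventually_elim (simp add: glue_def)
  ultimately show "(glue b \<sigma> \<rho> \<longlongrightarrow> 0) at_top"
    using Lim_transform_eventually by fastforce
  have "((\<lambda>n. \<Prod>j<nat (- n). \<sigma> j) \<longlongrightarrow> 0) at_bot"
    by (intro filterlim_compose[OF prod_tendsto_zero[OF assms(1,2)] filterlim_nat_minus_at_bot])
  moreover have "\<forall>\<^sub>F n in at_bot. (\<Prod>j<nat (- n). \<sigma> j) = glue b \<sigma> \<rho> n"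
    using eventually_le_at_bot[of 0] by eventually_elim (simp add: glue_def)
  ultimately show "(glue b \<sigma> \<rho> \<longlongrightarrow> 0) at_bot"
    using Lim_transform_eventually by fastforce
qed

text \<open>In the tails the equation is the Riccati relation; the two conditions on
  \<open>b\<close> are the equations at the sites 0 and 1.\<close>

lemma glue_equation:
  assumes \<sigma>: "\<And>j. \<sigma> j * (2 + s - V (- 1 - int j) - \<sigma> (Suc j)) = 1"
    and \<rho>: "\<And>j. \<rho> j * (2 + s - V (int j + 2) - \<rho> (Suc j)) = 1"
    and b: "b = 2 + s - V 0 - \<sigma> 0" "b * (2 + s - V 1 - \<rho> 0) = 1"
  shows "discrete_laplacian (glue b \<sigma> \<rho>) n + V n * glue b \<sigma> \<rho> n = s * glue b \<sigma> \<rho> n"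
proof -
  have step: "P * x * y - 2 * (P * x) + P + W * (P * x) = s * (P * x)"
    if "x * (2 + s - W - y) = 1" for P x y W :: real
  proof -
    have "P = P * (x * (2 + s - W - y))" using that by simp
    then show ?thesis by (simp add: algebra_simps)
  qed
  consider "n = 0" | "n = 1" | m where "n = - 1 - int m" | m where "n = int m + 2"
  proof -
    have "n = - 1 - int (nat (- 1 - n))" if "n < 0" using that by simp
    moreover have "n = int (nat (n - 2)) + 2" if "n > 1" using that by simp
    ultimately show ?thesis using that by (metis linorder_neqE_linordered_idom zless_imp_add1_zle add_0 order_less_le)
  qed
  then show ?thesis
  proof cases
    case 1
    then show ?thesis using b(1) by (simp add: discrete_laplacian_def glue_def)
  next
    case 2
    then show ?thesis using b(2) by (simp add: discrete_laplacian_def glue_def algebra_simps)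
  next
    case (3 m)
    have "nat (- n) = Suc m" "nat (- (n - 1)) = Suc (Suc m)" "nat (- (n + 1)) = m" "n \<le> - 1"
      using 3 by auto
    then show ?thesis
      using step[OF \<sigma>[of m], of "\<Prod>j<m. \<sigma> j"] unfolding 3[symmetric]
      by (simp add: discrete_laplacian_def glue_def)
  next
    case (4 m)
    have "nat (n - 1) = Suc m" "nat (n - 1 - 1) = m" "nat (n + 1 - 1) = Suc (Suc m)" "n \<ge> 2"
      using 4 by auto
    then show ?thesis
      using step[OF \<rho>[of m], of "b * (\<Prod>j<m. \<rho> j)"] unfolding 4[symmetric]
      by (simp add: discrete_laplacian_def glue_def algebra_simps)
  qed
qed

text \<open>For the exact dipole \<open>V n = k * dipole n\<close> the ground state is \<open>z ^ \<bar>n\<bar>\<close> for \<open>n \<le> 0\<close> and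
  \<open>(1 / z - k) * z ^ (n - 1)\<close> for \<open>n \<ge> 1\<close>, where the equation at the site \<open>1\<close> forces
  \<open>(1 / z)\<^sup>2 - k\<^sup>2 = 1\<close>.\<close>

definition dipole_rate :: "real \<Rightarrow> real" where
  "dipole_rate k = 1 / sqrt (1 + k\<^sup>2)"

definition dipole_level :: "real \<Rightarrow> real" where
  "dipole_level k = dipole_rate k + 1 / dipole_rate k - 2"

text \<open>The product formula is the equation at the site 1; \<open>k < 1 / z\<close> makes the
  ground state positive there.\<close>

lemma dipole_rate:
  assumes "0 < k"
  shows "0 < dipole_rate k" "dipole_rate k < 1"
    "(1 / dipole_rate k - k) * (1 / dipole_rate k + k) = 1" "k < 1 / dipole_rate k"
proof -
  have gt: "1 < 1 + k\<^sup>2" using assms by simp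
  have inv: "0 < 1 / r \<and> 1 / r < 1" if "1 < r" for r :: real using that by simp
  from gt have "1 < sqrt (1 + k\<^sup>2)" by (simp only: real_sqrt_gt_1_iff)
  then show "0 < dipole_rate k" "dipole_rate k < 1" unfolding dipole_rate_def using inv by blast+
  have sq: "(sqrt (1 + k\<^sup>2))\<^sup>2 = 1 + k\<^sup>2" by simp
  then show "(1 / dipole_rate k - k) * (1 / dipole_rate k + k) = 1"
    unfolding dipole_rate_def by (simp add: algebra_simps power2_eq_square)
  show "k < 1 / dipole_rate k" unfolding dipole_rate_def using assms by (simp add: real_less_rsqrt)
qed

lemma dipole_level_pos: "0 < k \<Longrightarrow> 0 < dipole_level k"
proof -
  assume k: "0 < k"
  have "dipole_level k = (1 - dipole_rate k)\<^sup>2 / dipole_rate k"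
    using dipole_rate[OF k] by (simp add: dipole_level_def power2_eq_square field_simps)
  then show ?thesis using dipole_rate[OF k] by simp
qed

text \<open>Once \<open>riccati_tail\<close> solves both tails, \<open>s\<close> is determined by
  one matching condition at the core. The last conclusion feeds the maximum principle.\<close>

lemma dipole_ground_state:
  fixes V :: "int \<Rightarrow> real"
  assumes k: "0 < k" and \<eta>: "0 \<le> \<eta>" "4 * \<eta> \<le> dipole_level k"
    and V: "\<And>n. \<bar>V n - k * dipole n\<bar> \<le> \<eta>"
  obtains s w where "\<bar>s - dipole_level k\<bar> \<le> \<eta>" "\<And>n. 0 < w n"
    "(w \<longlongrightarrow> 0) at_top" "(w \<longlongrightarrow> 0) at_bot"
    "\<And>n. discrete_laplacian w n + V n * w n = s * w n"
    "\<And>n. n \<noteq> 0 \<Longrightarrow> n \<noteq> 1 \<Longrightarrow> V n \<le> s"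
proof -
  define z where "z = dipole_rate k"
  define s\<^sub>0 where "s\<^sub>0 = z + 1 / z - 2"
  have level: "dipole_level k = s\<^sub>0" by (simp add: dipole_level_def s\<^sub>0_def z_def)
  have z: "0 < z" "z < 1" "(1 / z - k) * (1 / z + k) = 1" "k < 1 / z"
    using dipole_rate[OF k] by (simp_all add: z_def)
  have pos: "0 < s\<^sub>0" using dipole_level_pos[OF k] level by simp
  let ?I = "{s\<^sub>0 - \<eta>..s\<^sub>0 + \<eta>}"
  have Vtail: "\<bar>V n\<bar> \<le> \<eta>" if "n \<noteq> 0" "n \<noteq> 1" for n
    using V[of n] that by (simp add: dipole_def)
  have V0: "\<bar>V 0 - k\<bar> \<le> \<eta>" and V1: "\<bar>V 1 + k\<bar> \<le> \<eta>"
    using V[of 0] V[of 1] by (simp_all add: dipole_def)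
  define \<kappa> where "\<kappa> = 1 / (1 + s\<^sub>0 / 2)"
  have \<kappa>: "\<kappa> < 1" using pos by (simp add: \<kappa>_def)
  obtain \<rho> where \<rho>: "\<And>s j. s \<in> ?I \<Longrightarrow> 0 < \<rho> s j \<and> \<rho> s j \<le> \<kappa>"
    "\<And>s j. s \<in> ?I \<Longrightarrow> \<rho> s j * (2 + s - V (int j + 2) - \<rho> s (Suc j)) = 1"
    "continuous_on ?I (\<lambda>s. \<rho> s 0)" "\<rho> (s\<^sub>0 + \<eta>) 0 \<le> z" "z \<le> \<rho> (s\<^sub>0 - \<eta>) 0"
    using riccati_tail[of z \<eta> "\<lambda>j. V (int j + 2)"] z \<eta> Vtail unfolding level s\<^sub>0_def \<kappa>_def by auto
  obtain \<sigma> where \<sigma>: "\<And>s j. s \<in> ?I \<Longrightarrow> 0 < \<sigma> s j \<and> \<sigma> s j \<le> \<kappa>"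
    "\<And>s j. s \<in> ?I \<Longrightarrow> \<sigma> s j * (2 + s - V (- 1 - int j) - \<sigma> s (Suc j)) = 1"
    "continuous_on ?I (\<lambda>s. \<sigma> s 0)" "\<sigma> (s\<^sub>0 + \<eta>) 0 \<le> z" "z \<le> \<sigma> (s\<^sub>0 - \<eta>) 0"
    using riccati_tail[of z \<eta> "\<lambda>j. V (- 1 - int j)"] z \<eta> Vtail unfolding level s\<^sub>0_def \<kappa>_def by auto
  \<comment> \<open>The equation at the site 0 makes \<open>f s\<close> the value at the site 1,
    where the equation then reads \<open>f s * g s = 1\<close>.\<close>
  define f where "f s = 2 + s - V 0 - \<sigma> s 0" for s
  define g where "g s = 2 + s - V 1 - \<rho> s 0" for s
  have g_pos: "0 < g s" if "s \<in> ?I" for s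
    using \<rho>(1)[OF that, of 0] \<kappa> V1 that \<eta> k pos unfolding g_def level by (auto simp: abs_le_iff)
  have ends: "s\<^sub>0 - \<eta> \<in> ?I" "s\<^sub>0 + \<eta> \<in> ?I" using \<eta> by auto
  \<comment> \<open>The shift by \<eta> absorbs the perturbation, so the factors are bounded by
    \<open>1 / z - k\<close> and \<open>1 / z + k\<close>. The sign of \<open>f\<close> is not yet
    known, so they are replaced one at a time, using \<open>g > 0\<close>.\<close>
  have "f (s\<^sub>0 - \<eta>) * g (s\<^sub>0 - \<eta>) \<le> (1 / z - k) * g (s\<^sub>0 - \<eta>)"
    using \<sigma>(5) V0 g_pos[OF ends(1)] unfolding f_def s\<^sub>0_def
    by (intro mult_right_mono) (auto simp: abs_le_iff)
  also have "\<dots> \<le> (1 / z - k) * (1 / z + k)"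
    using \<rho>(5) V1 z unfolding g_def s\<^sub>0_def
    by (intro mult_left_mono) (auto simp: abs_le_iff)
  finally have lower: "f (s\<^sub>0 - \<eta>) * g (s\<^sub>0 - \<eta>) \<le> 1" using z by simp
  have "(1 / z - k) * (1 / z + k) \<le> f (s\<^sub>0 + \<eta>) * g (s\<^sub>0 + \<eta>)"
  proof (rule mult_mono')
    show "1 / z - k \<le> f (s\<^sub>0 + \<eta>)" using \<sigma>(4) V0 unfolding f_def s\<^sub>0_def by (auto simp: abs_le_iff)
    show "1 / z + k \<le> g (s\<^sub>0 + \<eta>)" using \<rho>(4) V1 unfolding g_def s\<^sub>0_def by (auto simp: abs_le_iff)
  qed (use z k in auto)
  then have upper: "1 \<le> f (s\<^sub>0 + \<eta>) * g (s\<^sub>0 + \<eta>)" using z by simp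
  have "continuous_on ?I (\<lambda>s. f s * g s)"
    unfolding f_def g_def by (intro continuous_intros \<rho>(3) \<sigma>(3))
  then obtain s where s: "s \<in> ?I" "f s * g s = 1"
    using IVT'[of "\<lambda>s. f s * g s", OF lower upper] \<eta> by auto
  have f_pos: "0 < f s" using s(2) g_pos[OF s(1)] by (metis zero_less_mult_pos2 zero_less_one)
  show ?thesis
  proof (rule that[of s "glue (f s) (\<sigma> s) (\<rho> s)"])
    show "\<bar>s - dipole_level k\<bar> \<le> \<eta>" using s(1) unfolding level by (auto simp: abs_le_iff)
    show "V n \<le> s" if "n \<noteq> 0" "n \<noteq> 1" for n
      using Vtail[OF that] s(1) \<eta> pos unfolding level by (auto simp: abs_le_iff)
    show "0 < glue (f s) (\<sigma> s) (\<rho> s) n" for n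
      using f_pos \<rho>(1)[OF s(1)] \<sigma>(1)[OF s(1)] by (intro glue_pos) auto
    show "(glue (f s) (\<sigma> s) (\<rho> s) \<longlongrightarrow> 0) at_top" "(glue (f s) (\<sigma> s) (\<rho> s) \<longlongrightarrow> 0) at_bot"
      by (rule glue_tendsto[OF \<kappa> \<sigma>(1)[OF s(1)] \<rho>(1)[OF s(1)]])+
    show "discrete_laplacian (glue (f s) (\<sigma> s) (\<rho> s)) n + V n * glue (f s) (\<sigma> s) (\<rho> s) n
        = s * glue (f s) (\<sigma> s) (\<rho> s) n" for n
      by (rule glue_equation) (use \<rho>(2)[OF s(1)] \<sigma>(2)[OF s(1)] s(2) in \<open>auto simp: f_def g_def\<close>)
  qed
qed

text \<open>Decay at both ends confines the values reaching \<open>z m\<close> to a finite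
  window.\<close>

lemma attains_positive_maximum:
  fixes z :: "int \<Rightarrow> real"
  assumes "(z \<longlongrightarrow> 0) at_top" "(z \<longlongrightarrow> 0) at_bot" and m: "0 < z m"
  shows "\<exists>n. 0 < z n \<and> (\<forall>j. z j \<le> z n)"
proof -
  obtain N where N: "\<And>n. N \<le> n \<Longrightarrow> z n < z m"
    using order_tendstoD(2)[OF assms(1) m] by (auto simp: eventually_at_top_linorder)
  obtain N' where N': "\<And>n. n \<le> N' \<Longrightarrow> z n < z m"
    using order_tendstoD(2)[OF assms(2) m] by (auto simp: eventually_at_bot_linorder)
  have m_in: "m \<in> {N'..N}" using N[of m] N'[of m] by force
  define M where "M = Max (z ` {N'..N})"
  have M: "z n \<le> M" if "n \<in> {N'..N}" for n using that by (auto simp: M_def)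
  have "M \<in> z ` {N'..N}" unfolding M_def using m_in by (intro Max_in) auto
  then obtain n where n: "z n = M" by auto
  show ?thesis
  proof (intro exI conjI allI)
    show "0 < z n" using M[OF m_in] m n by linarith
    fix j
    consider "j \<in> {N'..N}" | "N \<le> j" | "j \<le> N'" by force
    then show "z j \<le> z n"
      by cases (use M[of j] M[OF m_in] N[of j] N'[of j] n in auto)
  qed
qed

text \<open>Maximum principle for \<open>v - K w\<close>, where \<open>K\<close> is the least nonnegative multiple for which
  \<open>K w\<close> dominates \<open>v\<close> on the two core sites \<open>0\<close> and \<open>1\<close>.\<close>

lemma positive_solution_maximal:
  fixes v w V :: "int \<Rightarrow> real"
  assumes w: "\<And>n. 0 < w n" "(w \<longlongrightarrow> 0) at_top" "(w \<longlongrightarrow> 0) at_bot"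
    "\<And>n. discrete_laplacian w n + V n * w n = s * w n"
    and V: "\<And>n. n \<noteq> 0 \<Longrightarrow> n \<noteq> 1 \<Longrightarrow> V n \<le> s"
    and v: "0 < v m" "(v \<longlongrightarrow> 0) at_top" "(v \<longlongrightarrow> 0) at_bot"
    "\<And>n. discrete_laplacian v n + V n * v n = \<mu> * v n"
  shows "\<mu> \<le> s"
proof (rule ccontr)
  assume "\<not> \<mu> \<le> s"
  then have gt: "s < \<mu>" by simp
  define K where "K = max 0 (max (v 0 / w 0) (v 1 / w 1))"
  define z where "z n = v n - K * w n" for n
  have "K * w 0 \<ge> v 0 / w 0 * w 0" "K * w 1 \<ge> v 1 / w 1 * w 1"
    using w(1)[of 0] w(1)[of 1] by (intro mult_right_mono; simp add: K_def)+
  then have z01: "z 0 \<le> 0" "z 1 \<le> 0" using w(1)[of 0] w(1)[of 1] by (auto simp: z_def)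
  have K: "0 \<le> K" by (simp add: K_def)
  have z_lim: "(z \<longlongrightarrow> 0) at_top" "(z \<longlongrightarrow> 0) at_bot"
    using tendsto_diff[OF v(2) tendsto_mult[OF tendsto_const[of K] w(2)]]
      tendsto_diff[OF v(3) tendsto_mult[OF tendsto_const[of K] w(3)]] by (auto simp: z_def[abs_def])
  have lap: "discrete_laplacian z n = (s - V n) * z n + (\<mu> - s) * v n" for n
  proof -
    have "discrete_laplacian z n = discrete_laplacian v n - K * discrete_laplacian w n"
      by (simp add: z_def[abs_def] discrete_laplacian_def algebra_simps)
    also have "discrete_laplacian v n = (\<mu> - V n) * v n" using v(4)[of n] by (simp add: algebra_simps)
    also have "discrete_laplacian w n = (s - V n) * w n" using w(4)[of n] by (simp add: algebra_simps)
    also have "(\<mu> - V n) * v n - K * ((s - V n) * w n) = (s - V n) * z n + (\<mu> - s) * v n"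
      by (simp add: z_def algebra_simps)
    finally show ?thesis .
  qed
  have max_lap: "discrete_laplacian z n \<le> 0" if "\<And>j. z j \<le> z n" for n
    using that[of "n - 1"] that[of "n + 1"] by (simp add: discrete_laplacian_def)
  \<comment> \<open>A positive maximum would sit off the core, where \<open>V n \<le> s\<close> and
    \<open>v n > 0\<close> make the right-hand side of \<open>lap\<close> positive.\<close>
  have z_le: "z n \<le> 0" for n
  proof (rule ccontr)
    assume "\<not> z n \<le> 0"
    then have "0 < z n" by simp
    then obtain n where n: "0 < z n" "\<And>j. z j \<le> z n"
      using attains_positive_maximum[OF z_lim] by blast
    have "V n \<le> s" by (rule V) (use n(1) z01 in auto)
    then have "0 \<le> (s - V n) * z n" using n(1) by simp
    moreover have "0 \<le> K * w n" using K w(1)[of n] by simp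
    then have "0 < v n" using n(1) unfolding z_def by linarith
    then have "0 < (\<mu> - s) * v n" using gt by simp
    ultimately show False using max_lap[OF n(2)] lap[of n] by linarith
  qed
  \<comment> \<open>Now \<open>K w\<close> dominates \<open>v\<close> and touches it at a core site.
    There \<open>z\<close> is maximal and zero, so the term with \<open>s - V\<close> drops out of
    \<open>lap\<close>, whatever its sign.\<close>
  have "0 < K * w m" using z_le[of m] v(1) by (simp add: z_def)
  then have "0 < K" using w(1)[of m] by (simp add: zero_less_mult_iff)
  then obtain i where "K = v i / w i" by (auto simp: K_def max_def split: if_splits)
  then have i: "z i = 0" "0 < v i" using w(1)[of i] \<open>0 < K\<close> by (auto simp: z_def zero_less_divide_iff)
  have "0 < (\<mu> - s) * v i" using gt i(2) by simp
  also have "\<dots> = discrete_laplacian z i" using lap[of i] i(1) by simp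
  also have "\<dots> \<le> 0" by (rule max_lap) (use z_le i in auto)
  finally show False by simp
qed

subsection \<open>Expansion of the largest eigenvalue\<close>

context subcritical_bias
begin

lemma L1_eq:
  assumes "\<epsilon> \<noteq> 0"
  shows "L1 \<epsilon> \<gamma> v n = (- c + \<epsilon> * s) * v n \<longleftrightarrow>
    discrete_laplacian v n + (c - cos (kink1 \<epsilon> \<gamma> n + theta n)) / \<epsilon> * v n = s * v n"
  using assms unfolding L1_def by (simp add: field_simps)

text \<open>After division by \<epsilon> the potential is a dipole up to
  \<open>C * \<epsilon>\<close>, so the level moves by at most \<open>C * \<epsilon>\<close>;
  scaling back makes the error quadratic.\<close>

lemma largest_eigenvalue_expansion:
  defines "C \<equiv> (96 / c + (24 / c)\<^sup>2) / c"
  assumes "0 < \<gamma>" "0 < \<epsilon>" "\<epsilon> \<le> c\<^sup>2 / 96" "4 * (C * \<epsilon>) \<le> dipole_level (pi * \<gamma> / c)"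
  shows "\<exists>\<Lambda>. largest_eigenvalue (L1 \<epsilon> \<gamma>) \<Lambda> \<and>
    \<bar>\<Lambda> - (- c + \<epsilon> * dipole_level (pi * \<gamma> / c))\<bar> \<le> C * \<epsilon>\<^sup>2"
proof -
  define V where "V n = (c - cos (kink1 \<epsilon> \<gamma> n + theta n)) / \<epsilon>" for n
  have L1: "L1 \<epsilon> \<gamma> v n = (- c + \<epsilon> * s) * v n \<longleftrightarrow> discrete_laplacian v n + V n * v n = s * v n"
    for v n s
    unfolding V_def by (rule L1_eq) (use assms(3) in simp)
  have k: "0 < pi * \<gamma> / c" using assms c_pos by simp
  have C: "0 \<le> C * \<epsilon>" unfolding C_def using c_pos assms by simp
  obtain s w where s: "\<bar>s - dipole_level (pi * \<gamma> / c)\<bar> \<le> C * \<epsilon>"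
    and w: "\<And>n. 0 < w n" "(w \<longlongrightarrow> 0) at_top" "(w \<longlongrightarrow> 0) at_bot"
      "\<And>n. discrete_laplacian w n + V n * w n = s * w n"
    and V: "\<And>n. n \<noteq> 0 \<Longrightarrow> n \<noteq> 1 \<Longrightarrow> V n \<le> s"
    using dipole_ground_state[OF k C assms(5), of V] potential_expansion[OF assms(3,4)]
    unfolding V_def C_def by blast
  have "eigenvalue (L1 \<epsilon> \<gamma>) (- c + \<epsilon> * s)"
    unfolding eigenvalue_def
  proof (intro exI conjI allI)
    show "w 0 \<noteq> 0" using w(1)[of 0] by simp
    show "L1 \<epsilon> \<gamma> w n = (- c + \<epsilon> * s) * w n" for n unfolding L1 by (rule w(4))
  qed (rule w)+
  moreover have "\<mu> \<le> - c + \<epsilon> * s" if ev: "eigenvalue (L1 \<epsilon> \<gamma>) \<mu>" for \<mu>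
  proof -
    define \<nu> where "\<nu> = (\<mu> + c) / \<epsilon>"
    have \<mu>: "\<mu> = - c + \<epsilon> * \<nu>" using assms(3) by (simp add: \<nu>_def)
    obtain v m where v: "v m \<noteq> 0" "(v \<longlongrightarrow> 0) at_top" "(v \<longlongrightarrow> 0) at_bot"
        "\<And>n. L1 \<epsilon> \<gamma> v n = (- c + \<epsilon> * \<nu>) * v n"
      using ev unfolding eigenvalue_def \<mu> by blast
    have eq: "discrete_laplacian v n + V n * v n = \<nu> * v n" for n
      using v(4)[of n] unfolding L1 .
    \<comment> \<open>Up to sign, a nonzero eigenfunction is positive somewhere, as the maximum
      principle requires.\<close>
    have "\<nu> \<le> s"
    proof (cases "0 < v m")
      case True
      show ?thesis by (rule positive_solution_maximal[OF w]) (fact V True v(2,3) eq)+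
    next
      case False
      then have pos: "0 < - v m" using v(1) by simp
      have lim: "((\<lambda>n. - v n) \<longlongrightarrow> 0) at_top" "((\<lambda>n. - v n) \<longlongrightarrow> 0) at_bot"
        using tendsto_minus[OF v(2)] tendsto_minus[OF v(3)] by simp_all
      have neg: "discrete_laplacian (\<lambda>n. - v n) n + V n * - v n = \<nu> * - v n" for n
        using eq[of n] by (simp add: discrete_laplacian_def algebra_simps)
      show ?thesis
        by (rule positive_solution_maximal[where v = "\<lambda>n. - v n", OF w]) (fact V pos lim neg)+
    qed
    then show ?thesis unfolding \<mu> using assms(3) by simp
  qed
  moreover have "\<bar>(- c + \<epsilon> * s) - (- c + \<epsilon> * dipole_level (pi * \<gamma> / c))\<bar> \<le> C * \<epsilon>\<^sup>2"
  proof -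
    have "(- c + \<epsilon> * s) - (- c + \<epsilon> * dipole_level (pi * \<gamma> / c)) = \<epsilon> * (s - dipole_level (pi * \<gamma> / c))"
      by (simp add: algebra_simps)
    also have "\<bar>\<dots>\<bar> \<le> \<epsilon> * (C * \<epsilon>)"
      unfolding abs_mult using s assms(3) by (simp add: mult_left_mono)
    finally show ?thesis by (simp add: power2_eq_square algebra_simps)
  qed
  ultimately show ?thesis unfolding largest_eigenvalue_def by blast
qed

end

theorem lemma5p2:
  fixes \<gamma> :: real
  assumes "0 < \<gamma>" and "\<gamma> < 1"
  shows "\<exists>\<Lambda> :: real \<Rightarrow> real.
           (\<forall>\<^sub>F \<epsilon> in at_right 0. largest_eigenvalue (L1 \<epsilon> \<gamma>) (\<Lambda> \<epsilon>)) \<and>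
           (\<exists>\<Lambda>\<^sub>0 \<Lambda>\<^sub>1 :: real.
              (\<lambda>\<epsilon>. \<Lambda> \<epsilon> - (\<Lambda>\<^sub>0 + \<epsilon> * \<Lambda>\<^sub>1)) \<in> O[at_right 0](\<lambda>\<epsilon>. \<epsilon>\<^sup>2) \<and>
              (\<forall>\<^sub>F \<epsilon> in at_right 0. \<Lambda>\<^sub>0 + \<epsilon> * \<Lambda>\<^sub>1 < 0))"
proof -
  interpret subcritical_bias \<gamma> using assms by unfold_locales auto
  define C where "C = (96 / c + (24 / c)\<^sup>2) / c"
  define \<Lambda>\<^sub>1 where "\<Lambda>\<^sub>1 = dipole_level (pi * \<gamma> / c)"
  \<comment> \<open>The three bounds secure, in order, the kink, the ground state, and
    \<open>\<epsilon> * \<Lambda>\<^sub>1 < c\<close>; the first-order correction itself is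
    positive.\<close>
  define \<epsilon>\<^sub>0 where "\<epsilon>\<^sub>0 = min (c\<^sup>2 / 96) (min (\<Lambda>\<^sub>1 / (4 * C)) (c / \<Lambda>\<^sub>1))"
  have C: "0 < C" unfolding C_def using c_pos by (intro divide_pos_pos add_pos_pos) auto
  have \<Lambda>\<^sub>1: "0 < \<Lambda>\<^sub>1" unfolding \<Lambda>\<^sub>1_def using assms c_pos by (intro dipole_level_pos) auto
  have small: "\<forall>\<^sub>F \<epsilon> in at_right 0. \<epsilon> \<in> {0<..<\<epsilon>\<^sub>0}"
    by (rule eventually_at_right_real) (use C \<Lambda>\<^sub>1 c_pos in \<open>simp add: \<epsilon>\<^sub>0_def\<close>)
  have "\<exists>\<Lambda>. largest_eigenvalue (L1 \<epsilon> \<gamma>) \<Lambda> \<and> \<bar>\<Lambda> - (- c + \<epsilon> * \<Lambda>\<^sub>1)\<bar> \<le> C * \<epsilon>\<^sup>2"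
    if "\<epsilon> \<in> {0<..<\<epsilon>\<^sub>0}" for \<epsilon>
    unfolding \<Lambda>\<^sub>1_def C_def
    by (rule largest_eigenvalue_expansion)
       (use that assms C in \<open>auto simp: \<epsilon>\<^sub>0_def C_def[symmetric] \<Lambda>\<^sub>1_def[symmetric] pos_less_divide_eq algebra_simps\<close>)
  then have "\<exists>\<Lambda>. \<forall>\<epsilon>\<in>{0<..<\<epsilon>\<^sub>0}. largest_eigenvalue (L1 \<epsilon> \<gamma>) (\<Lambda> \<epsilon>) \<and>
      \<bar>\<Lambda> \<epsilon> - (- c + \<epsilon> * \<Lambda>\<^sub>1)\<bar> \<le> C * \<epsilon>\<^sup>2"
    by (intro bchoice ballI)
  then obtain \<Lambda> where \<Lambda>: "\<And>\<epsilon>. \<epsilon> \<in> {0<..<\<epsilon>\<^sub>0} \<Longrightarrow> largest_eigenvalue (L1 \<epsilon> \<gamma>) (\<Lambda> \<epsilon>)"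
      "\<And>\<epsilon>. \<epsilon> \<in> {0<..<\<epsilon>\<^sub>0} \<Longrightarrow> \<bar>\<Lambda> \<epsilon> - (- c + \<epsilon> * \<Lambda>\<^sub>1)\<bar> \<le> C * \<epsilon>\<^sup>2"
    by blast
  show ?thesis
  proof (intro exI conjI)
    show "\<forall>\<^sub>F \<epsilon> in at_right 0. largest_eigenvalue (L1 \<epsilon> \<gamma>) (\<Lambda> \<epsilon>)"
      using small by eventually_elim (rule \<Lambda>)
    show "(\<lambda>\<epsilon>. \<Lambda> \<epsilon> - (- c + \<epsilon> * \<Lambda>\<^sub>1)) \<in> O[at_right 0](\<lambda>\<epsilon>. \<epsilon>\<^sup>2)"
      by (rule bigoI[of _ C], use small in eventually_elim) (use \<Lambda>(2) in auto)
    show "\<forall>\<^sub>F \<epsilon> in at_right 0. - c + \<epsilon> * \<Lambda>\<^sub>1 < 0"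
      using small by eventually_elim (use \<Lambda>\<^sub>1 in \<open>simp add: \<epsilon>\<^sub>0_def pos_less_divide_eq\<close>)
  qed
qed

end
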